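(* Let $G$ and $H$ be finitely generated groups which are two-sided configuration equivalent, i.e. $\operatorname{Con}_{\mathrm t}(G)=\operatorname{Con}_{\mathrm t}(H)$. Then $G$ and $H$ have the same class number.
   Context: A configuration pair $(\mathfrak g,\mathcal E)$ of a finitely generated (discrete) group $G$ consists of an ordered generating set, i.e. a finite tuple $\mathfrak g=(g_1,\dots,g_n)$ of elements of $G$ whose entries generate $G$ as a group, and a finite partition $\mathcal E=\{E_1,\dots,E_m\}$ of $G$ with indexed blocks. A two-sided configuration corresponding to $(\mathfrak g,\mathcal E)$ is a $(2n+1)$-tuple $C=(c_0,c_1,\dots,c_{2n})$ with $c_i\in\{1,\dots,m\}$ for which there exists $x\in E_{c_0}$ such that $g_ix\in E_{c_i}$ and $xg_i\in E_{c_{i+n}}$ for each $i\in\{1,\dots,n\}$. The set of all of these is denoted $\operatorname{Con}_{\mathrm t}(\mathfrak g,\mathcal E)$. $\operatorname{Con}_{\mathrm t}(G)$ is the set of all sets $\operatorname{Con}_{\mathrm t}(\mathfrak g,\mathcal E)$, where $(\mathfrak g,\mathcal E)$ ranges over all configuration pairs of $G$. Two groups are two-sided configuration equivalent, written $G\approx_{\mathrm t}H$, if $\operatorname{Con}_{\mathrm t}(G)=\operatorname{Con}_{\mathrm t}(H)$. The class number of a group is the number of its different conjugacy classes (possibly infinite). *)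

theory Defs
  imports "HOL-Algebra.Algebra" "HOL-Library.Disjoint_Sets" "HOL-Library.Equipollence"
begin

definition finitely_generated_group :: "('a, 'b) monoid_scheme \<Rightarrow> bool" where
  "finitely_generated_group G \<longleftrightarrow>
     group G \<and> (\<exists>A. finite A \<and> A \<subseteq> carrier G \<and> generate G A = carrier G)"

text \<open>A tuple \<open>(g\<^sub>1, \<dots>, g\<^sub>n)\<close> and an indexed partition \<open>{E\<^sub>1, \<dots>, E\<^sub>m}\<close> are represented by lists
  \<open>gs\<close> and \<open>Es\<close>; as list positions start at 0, \<open>g\<^sub>i\<close> is \<open>gs ! (i - 1)\<close> and \<open>E\<^sub>j\<close> is \<open>Es ! (j - 1)\<close>.
  Distinctness of \<open>Es\<close> says that different indices denote different blocks.\<close>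

definition configuration_pair :: "('a, 'b) monoid_scheme \<Rightarrow> 'a list \<Rightarrow> 'a set list \<Rightarrow> bool" where
  "configuration_pair G gs Es \<longleftrightarrow>
     set gs \<subseteq> carrier G \<and> generate G (set gs) = carrier G \<and>
     distinct Es \<and> partition_on (carrier G) (set Es)"

text \<open>A configuration \<open>(c\<^sub>0, \<dots>, c\<^sub>2\<^sub>n)\<close> is a list \<open>C\<close> with \<open>c\<^sub>i = C ! i\<close>. The number \<open>m\<close> of blocks
  is not recorded in the resulting set of configurations.\<close>

definition Con_t_pair :: "('a, 'b) monoid_scheme \<Rightarrow> 'a list \<Rightarrow> 'a set list \<Rightarrow> nat list set" where
  "Con_t_pair G gs Es =
     {C. length C = 2 * length gs + 1 \<and> set C \<subseteq> {1..length Es} \<and>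
         (\<exists>x \<in> Es ! (C ! 0 - 1). \<forall>i \<in> {1..length gs}.
             gs ! (i - 1) \<otimes>\<^bsub>G\<^esub> x \<in> Es ! (C ! i - 1) \<and>
             x \<otimes>\<^bsub>G\<^esub> gs ! (i - 1) \<in> Es ! (C ! (i + length gs) - 1))}"

definition Con_t :: "('a, 'b) monoid_scheme \<Rightarrow> nat list set set" where
  "Con_t G = {Con_t_pair G gs Es | gs Es. configuration_pair G gs Es}"

definition conjugacy_class :: "('a, 'b) monoid_scheme \<Rightarrow> 'a \<Rightarrow> 'a set" where
  "conjugacy_class G x = {g \<otimes>\<^bsub>G\<^esub> x \<otimes>\<^bsub>G\<^esub> inv\<^bsub>G\<^esub> g | g. g \<in> carrier G}"

definition conjugacy_classes :: "('a, 'b) monoid_scheme \<Rightarrow> 'a set set" where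
  "conjugacy_classes G = conjugacy_class G ` carrier G"

text \<open>Class numbers may be infinite, so their equality is equality of cardinalities
  (\<^const>\<open>eqpoll\<close>); \<^const>\<open>card\<close> would identify infinite class numbers with 0.\<close>

definition same_class_number :: "('a, 'b) monoid_scheme \<Rightarrow> ('c, 'd) monoid_scheme \<Rightarrow> bool" where
  "same_class_number G H \<longleftrightarrow> conjugacy_classes G \<approx> conjugacy_classes H"

definition two_sided_equivalent :: "('a, 'b) monoid_scheme \<Rightarrow> ('c, 'd) monoid_scheme \<Rightarrow> bool" where
  "two_sided_equivalent G H \<longleftrightarrow> Con_t G = Con_t H"

end

theory Submission
  imports Defs "HOL-Library.Countable_Set"
begin

text \<open>The elements \<open>g x\<close> and \<open>x g\<close> are conjugate, and every pair \<open>y\<close>, \<open>g y g\<^sup>-\<^sup>1\<close> arises in this way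
  as \<open>x g\<close>, \<open>g x\<close>. Hence all blocks of a partition are unions of conjugacy classes if and only if every
  two-sided configuration satisfies \<open>c\<^sub>i = c\<^sub>i\<^sub>+\<^sub>n\<close> for all \<open>i\<close>. Since \<open>n\<close> and the number of blocks can be
  read off the set of configurations, equivalent groups have the same finite numbers \<open>m\<close> for which there
  are at least \<open>m\<close> conjugacy classes. If the class numbers are infinite, both are countable, because
  finitely generated groups are countable.\<close>

subsection \<open>Configurations of elements\<close>

text \<open>Counts from 1, as the entries of configurations do. The value is meaningful only when
  \<open>z\<close> lies in exactly one block of a list without repetitions, so it is used through
  the characterisation below.\<close>

definition block_index :: "'a set list \<Rightarrow> 'a \<Rightarrow> nat" where
  "block_index Es z = (THE j. j \<in> {1..length Es} \<and> z \<in> Es ! (j - 1))"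

text \<open>This replaces the existential witness in \<open>Con_t_pair\<close> by a function of
  \<open>x\<close>.\<close>

definition config_of :: "('a, 'b) monoid_scheme \<Rightarrow> 'a list \<Rightarrow> 'a set list \<Rightarrow> 'a \<Rightarrow> nat list" where
  "config_of G gs Es x =
     block_index Es x # map (\<lambda>g. block_index Es (g \<otimes>\<^bsub>G\<^esub> x)) gs @ map (\<lambda>g. block_index Es (x \<otimes>\<^bsub>G\<^esub> g)) gs"

text \<open>Existence comes from the covering, uniqueness from disjointness of the blocks together
  with distinctness of the list.\<close>

lemma block_index_eq_iff:
  assumes "distinct Es" "partition_on A (set Es)" "z \<in> A"
  shows "block_index Es z = j \<longleftrightarrow> j \<in> {1..length Es} \<and> z \<in> Es ! (j - 1)"
proof -
  obtain k where k: "k < length Es" "z \<in> Es ! k"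
    using assms by (metis UnionE in_set_conv_nth partition_onD1)
  have unique: "i = k" if "i < length Es" "z \<in> Es ! i" for i
    using that k assms
    by (metis disjointD disjoint_iff nth_eq_iff_index_eq nth_mem partition_onD2)
  have ex1: "\<exists>!j. j \<in> {1..length Es} \<and> z \<in> Es ! (j - 1)"
  proof (rule ex1I[of _ "Suc k"])
    fix j assume "j \<in> {1..length Es} \<and> z \<in> Es ! (j - 1)"
    then show "j = Suc k" using unique[of "j - 1"] by auto
  qed (use k in auto)
  then show ?thesis
    unfolding block_index_def using theI'[OF ex1] by blast
qed

text \<open>Every index is attained because the blocks of a partition are nonempty.\<close>

lemma block_index_image:
  assumes "distinct Es" "partition_on A (set Es)"
  shows "block_index Es ` A = {1..length Es}"
proof (intro equalityI subsetI)
  fix j assume "j \<in> block_index Es ` A"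
  then show "j \<in> {1..length Es}" using block_index_eq_iff[OF assms] by blast
next
  fix j assume j: "j \<in> {1..length Es}"
  then have "Es ! (j - 1) \<in> set Es" by (intro nth_mem) auto
  then obtain z where z: "z \<in> Es ! (j - 1)" "z \<in> A"
    using assms(2) by (metis UnionI all_not_in_conv partition_onD1 partition_onD3)
  then show "j \<in> block_index Es ` A"
    using block_index_eq_iff[OF assms z(2), of j] j by blast
qed

text \<open>Turns equality of configuration entries into a condition on each block separately, the
  form in which invariance of a block is expressed.\<close>

lemma block_index_eq_iff_same_blocks:
  assumes "distinct Es" "partition_on A (set Es)" "y \<in> A" "z \<in> A"
  shows "block_index Es y = block_index Es z \<longleftrightarrow> (\<forall>E \<in> set Es. y \<in> E \<longleftrightarrow> z \<in> E)"
proof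
  assume eq: "block_index Es y = block_index Es z"
  show "\<forall>E \<in> set Es. y \<in> E \<longleftrightarrow> z \<in> E"
  proof
    fix E assume "E \<in> set Es"
    then obtain k where k: "k < length Es" "E = Es ! k" by (metis in_set_conv_nth)
    show "y \<in> E \<longleftrightarrow> z \<in> E"
      using eq k block_index_eq_iff[OF assms(1,2,3), of "Suc k"]
        block_index_eq_iff[OF assms(1,2,4), of "Suc k"] by auto
  qed
next
  assume iff: "\<forall>E \<in> set Es. y \<in> E \<longleftrightarrow> z \<in> E"
  let ?j = "block_index Es z"
  have "?j \<in> {1..length Es}" "z \<in> Es ! (?j - 1)"
    using block_index_eq_iff[OF assms(1,2,4)] by blast+
  moreover from this have "Es ! (?j - 1) \<in> set Es" by (intro nth_mem) auto
  ultimately show "block_index Es y = ?j"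
    using iff block_index_eq_iff[OF assms(1,2,3)] by blast
qed

lemma length_config_of [simp]: "length (config_of G gs Es x) = 2 * length gs + 1"
  by (simp add: config_of_def)

lemma config_of_nth_0 [simp]: "config_of G gs Es x ! 0 = block_index Es x"
  by (simp add: config_of_def)

lemma config_of_nth_left:
  "i < length gs \<Longrightarrow> config_of G gs Es x ! Suc i = block_index Es (gs ! i \<otimes>\<^bsub>G\<^esub> x)"
  by (simp add: config_of_def nth_append)

lemma config_of_nth_right:
  "i < length gs \<Longrightarrow>
    config_of G gs Es x ! Suc (i + length gs) = block_index Es (x \<otimes>\<^bsub>G\<^esub> gs ! i)"
  by (simp add: config_of_def nth_append)

text \<open>The blocks containing \<open>x\<close> and its products are unique, so a witness
  \<open>x\<close> determines the whole configuration.\<close>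

lemma Con_t_pair_eq_image:
  fixes G (structure)
  assumes "group G" "configuration_pair G gs Es"
  shows "Con_t_pair G gs Es = config_of G gs Es ` carrier G"
proof -
  interpret group G by fact
  have Es: "distinct Es" "partition_on (carrier G) (set Es)" and gs: "set gs \<subseteq> carrier G"
    using assms(2) by (auto simp: configuration_pair_def)
  note iff = block_index_eq_iff[OF Es]
  have gs_nth: "gs ! i \<in> carrier G" if "i < length gs" for i
    using gs that nth_mem by blast
  show ?thesis
  proof (intro equalityI subsetI)
    fix C assume "C \<in> Con_t_pair G gs Es"
    then obtain x where len: "length C = 2 * length gs + 1" and C: "set C \<subseteq> {1..length Es}"
      and x: "x \<in> Es ! (C ! 0 - 1)"
      and nbrs: "\<And>i. i \<in> {1..length gs} \<Longrightarrow> gs ! (i - 1) \<otimes> x \<in> Es ! (C ! i - 1) \<and>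
        x \<otimes> gs ! (i - 1) \<in> Es ! (C ! (i + length gs) - 1)"
      unfolding Con_t_pair_def by blast
    \<comment> \<open>These bounds make every \<open>C ! i - 1\<close> a genuine position of
      \<open>Es\<close>; beyond the list, \<open>nth\<close> would be unspecified.\<close>
    have nth: "C ! i \<in> {1..length Es}" if "i < 2 * length gs + 1" for i
      using C len that by (metis nth_mem subsetD)
    have "C ! 0 - 1 < length Es" using nth[of 0] by auto
    then have xG: "x \<in> carrier G"
      using x Es(2) nth_mem by (metis UnionI partition_onD1)
    have "config_of G gs Es x = C"
    proof (rule nth_equalityI)
      fix j assume "j < length (config_of G gs Es x)"
      \<comment> \<open>The cases are the base point, the left products and the right
        products.\<close>
      then consider "j = 0" | i where "i < length gs" "j = Suc i"
        | i where "i < length gs" "j = Suc (i + length gs)"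
        by (cases j) (simp, metis Suc_eq_plus1 add.commute add_less_cancel_left length_config_of
            less_diff_conv2 le_add_diff_inverse mult_2 not_less not_less_eq)
      then show "config_of G gs Es x ! j = C ! j"
      proof cases
        case 1
        then show ?thesis using iff[OF xG, of "C ! 0"] x nth[of 0] by simp
      next
        case 2
        then have "block_index Es (gs ! i \<otimes> x) = C ! Suc i"
          using iff[of "gs ! i \<otimes> x" "C ! Suc i"] nth[of "Suc i"] nbrs[of "Suc i"] gs_nth[of i] xG
          by auto
        then show ?thesis using 2 by (simp add: config_of_nth_left)
      next
        case 3
        then have "block_index Es (x \<otimes> gs ! i) = C ! Suc (i + length gs)"
          using iff[of "x \<otimes> gs ! i" "C ! Suc (i + length gs)"] nth[of "Suc (i + length gs)"]
            nbrs[of "Suc i"] gs_nth[of i] xG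
          by auto
        then show ?thesis using 3 by (simp add: config_of_nth_right)
      qed
    qed (simp add: len)
    then show "C \<in> config_of G gs Es ` carrier G" using xG by blast
  next
    fix C assume "C \<in> config_of G gs Es ` carrier G"
    then obtain x where x: "x \<in> carrier G" and C: "C = config_of G gs Es x" by blast
    have index: "block_index Es z \<in> {1..length Es}" "z \<in> Es ! (block_index Es z - 1)"
      if "z \<in> carrier G" for z using iff[OF that] by blast+
    have "set C \<subseteq> {1..length Es}"
      unfolding C config_of_def using index(1) x gs by (auto simp del: atLeastAtMost_iff)
    moreover have "gs ! (i - 1) \<otimes> x \<in> Es ! (C ! i - 1)
        \<and> x \<otimes> gs ! (i - 1) \<in> Es ! (C ! (i + length gs) - 1)" if "i \<in> {1..length gs}" for i
    proof -
      obtain k where k: "i = Suc k" "k < length gs" using \<open>i \<in> {1..length gs}\<close> by (cases i) auto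
      show ?thesis
        using index(2) gs_nth[OF k(2)] x k(2)
        by (simp add: C k(1) config_of_nth_left config_of_nth_right)
    qed
    moreover have "x \<in> Es ! (C ! 0 - 1)" using index(2)[OF x] by (simp add: C)
    ultimately show "C \<in> Con_t_pair G gs Es"
      unfolding Con_t_pair_def using x by (intro CollectI conjI bexI[of _ x] ballI) (auto simp: C)
  qed
qed

text \<open>Recovers the number of blocks from the set of configurations alone.\<close>

lemma Con_t_pair_nth_0_image:
  assumes "group G" "configuration_pair G gs Es"
  shows "(\<lambda>C. C ! 0) ` Con_t_pair G gs Es = {1..length Es}"
  using assms(2)
  by (simp add: Con_t_pair_eq_image[OF assms] image_image configuration_pair_def block_index_image)

text \<open>The left side mentions only the set of configurations and the length of the tuple, so it
  carries over to any pair that shares both. The right side is invariance tested on the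
  generators.\<close>

lemma Con_t_pair_symmetric_iff:
  fixes G (structure)
  assumes "group G" "configuration_pair G gs Es"
  shows "(\<forall>C \<in> Con_t_pair G gs Es. \<forall>i < length gs. C ! Suc i = C ! Suc (i + length gs)) \<longleftrightarrow>
    (\<forall>E \<in> set Es. \<forall>g \<in> set gs. \<forall>x \<in> carrier G. g \<otimes>\<^bsub>G\<^esub> x \<in> E \<longleftrightarrow> x \<otimes>\<^bsub>G\<^esub> g \<in> E)"
proof -
  interpret group G by fact
  have Es: "distinct Es" "partition_on (carrier G) (set Es)" and gs: "set gs \<subseteq> carrier G"
    using assms(2) by (auto simp: configuration_pair_def)
  have "(\<forall>C \<in> Con_t_pair G gs Es. \<forall>i < length gs. C ! Suc i = C ! Suc (i + length gs)) \<longleftrightarrow>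
    (\<forall>x \<in> carrier G. \<forall>g \<in> set gs. block_index Es (g \<otimes> x) = block_index Es (x \<otimes> g))"
    by (simp add: Con_t_pair_eq_image[OF assms] config_of_nth_left config_of_nth_right
        all_set_conv_all_nth)
  also have "\<dots> \<longleftrightarrow>
    (\<forall>x \<in> carrier G. \<forall>g \<in> set gs. \<forall>E \<in> set Es. g \<otimes> x \<in> E \<longleftrightarrow> x \<otimes> g \<in> E)"
    using gs by (intro ball_cong refl block_index_eq_iff_same_blocks[OF Es]) auto
  finally show ?thesis by blast
qed

subsection \<open>Conjugation-invariant sets\<close>

text \<open>Stated with the two products that configurations record. For subsets of the carrier this
  is closure under conjugation, see \<open>conj_invariant_iff\<close>.\<close>

definition conj_invariant :: "('a, 'b) monoid_scheme \<Rightarrow> 'a set \<Rightarrow> bool" where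
  "conj_invariant G E \<longleftrightarrow>
     (\<forall>g \<in> carrier G. \<forall>x \<in> carrier G. g \<otimes>\<^bsub>G\<^esub> x \<in> E \<longleftrightarrow> x \<otimes>\<^bsub>G\<^esub> g \<in> E)"

context group
begin

text \<open>The elements \<open>g\<close> that can be moved across every \<open>x\<close> without
  changing membership in \<open>E\<close> form a subgroup.\<close>

lemma conj_invariant_generate:
  assumes "generate G S = carrier G" "S \<subseteq> carrier G"
    and S: "\<And>g x. g \<in> S \<Longrightarrow> x \<in> carrier G \<Longrightarrow> g \<otimes> x \<in> E \<longleftrightarrow> x \<otimes> g \<in> E"
  shows "conj_invariant G E"
proof -
  have "\<forall>x \<in> carrier G. g \<otimes> x \<in> E \<longleftrightarrow> x \<otimes> g \<in> E" if "g \<in> generate G S" for g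
    using that
  proof (induction g rule: generate.induct)
    case one
    then show ?case by simp
  next
    case (incl h)
    then show ?case using S by blast
  next
    case (inv h)
    then have h: "h \<in> carrier G" using assms(2) by blast
    show ?case
    proof
      fix x assume x: "x \<in> carrier G"
      \<comment> \<open>Chosen so that multiplying by \<open>h\<close> on the left cancels the left
        \<open>inv h\<close>, and on the right the right one. The hypothesis for \<open>h\<close> at
        \<open>?z\<close> is then the claim with its sides exchanged.\<close>
      let ?z = "inv h \<otimes> x \<otimes> inv h"
      have "h \<otimes> (inv h \<otimes> (x \<otimes> inv h)) = x \<otimes> inv h"
        using h x by (metis inv_closed inv_solve_left m_closed)
      then have "h \<otimes> ?z = x \<otimes> inv h" "?z \<otimes> h = inv h \<otimes> x"
        using h x by (simp_all add: m_assoc)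
      then show "inv h \<otimes> x \<in> E \<longleftrightarrow> x \<otimes> inv h \<in> E"
        using S[OF inv, of ?z] h x by simp
    qed
  next
    case (eng h k)
    then have "h \<in> carrier G" "k \<in> carrier G" using assms(1) by auto
    \<comment> \<open>The factors are moved one at a time: \<open>h\<close> across
      \<open>k \<otimes> x\<close>, then \<open>k\<close> across
      \<open>x \<otimes> h\<close>.\<close>
    then show ?case using eng.IH by (simp add: m_assoc)
  qed
  then show ?thesis unfolding conj_invariant_def assms(1) by blast
qed

lemma conj_invariant_iff:
  assumes "E \<subseteq> carrier G"
  shows "conj_invariant G E \<longleftrightarrow> (\<forall>x \<in> E. conjugacy_class G x \<subseteq> E)"
proof
  assume inv: "conj_invariant G E"
  show "\<forall>x \<in> E. conjugacy_class G x \<subseteq> E"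
  proof (intro ballI subsetI)
    fix x y assume x: "x \<in> E" and "y \<in> conjugacy_class G x"
    then obtain g where g: "g \<in> carrier G" "y = g \<otimes> x \<otimes> inv g"
      unfolding conjugacy_class_def by blast
    have xG: "x \<in> carrier G" using x assms by blast
    have "(x \<otimes> inv g) \<otimes> g \<in> E" using x xG g by (simp add: m_assoc)
    then have "g \<otimes> (x \<otimes> inv g) \<in> E"
      using inv xG g by (simp add: conj_invariant_def)
    then show "y \<in> E" using xG g by (simp add: m_assoc)
  qed
next
  assume closed: "\<forall>x \<in> E. conjugacy_class G x \<subseteq> E"
  \<comment> \<open>One implication suffices, since exchanging the roles of \<open>h\<close> and
    \<open>y\<close> gives the other.\<close>
  have comm: "h \<otimes> y \<in> E" if "y \<otimes> h \<in> E" "h \<in> carrier G" "y \<in> carrier G" for h y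
  proof -
    have "h \<otimes> (y \<otimes> h) \<otimes> inv h = h \<otimes> y" using that by (simp add: m_assoc)
    then have "h \<otimes> y \<in> conjugacy_class G (y \<otimes> h)"
      unfolding conjugacy_class_def using that by force
    then show ?thesis using closed that by blast
  qed
  then show "conj_invariant G E" unfolding conj_invariant_def by blast
qed

section \<open>Conjugacy classes and invariant partitions\<close>

lemma conjugacy_class_subset: "x \<in> carrier G \<Longrightarrow> conjugacy_class G x \<subseteq> carrier G"
  by (auto simp: conjugacy_class_def)

lemma conjugacy_class_self: "x \<in> carrier G \<Longrightarrow> x \<in> conjugacy_class G x"
  unfolding conjugacy_class_def by (force intro: exI[of _ \<one>])

lemma conjugacy_class_mono:
  assumes "x \<in> carrier G" "y \<in> conjugacy_class G x"
  shows "conjugacy_class G y \<subseteq> conjugacy_class G x"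
proof
  obtain g where g: "g \<in> carrier G" "y = g \<otimes> x \<otimes> inv g"
    using assms(2) unfolding conjugacy_class_def by blast
  fix z assume "z \<in> conjugacy_class G y"
  then obtain h where h: "h \<in> carrier G" "z = h \<otimes> y \<otimes> inv h"
    unfolding conjugacy_class_def by blast
  have "z = (h \<otimes> g) \<otimes> x \<otimes> inv (h \<otimes> g)"
    using g h assms(1) by (simp add: m_assoc inv_mult_group)
  then show "z \<in> conjugacy_class G x"
    unfolding conjugacy_class_def using g h by blast
qed

lemma conjugacy_class_eq:
  assumes "x \<in> carrier G" "y \<in> conjugacy_class G x"
  shows "conjugacy_class G y = conjugacy_class G x"
proof -
  obtain g where g: "g \<in> carrier G" "y = g \<otimes> x \<otimes> inv g"
    using assms(2) unfolding conjugacy_class_def by blast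
  have "x = inv g \<otimes> y \<otimes> inv (inv g)"
    using g assms(1) by (simp add: m_assoc) (simp flip: m_assoc)
  then have "x \<in> conjugacy_class G y"
    unfolding conjugacy_class_def using g(1) by blast
  then show ?thesis
    using conjugacy_class_mono assms conjugacy_class_subset by blast
qed

lemma partition_on_conjugacy_classes: "partition_on (carrier G) (conjugacy_classes G)"
proof (rule partition_onI)
  show "\<Union> (conjugacy_classes G) = carrier G"
    unfolding conjugacy_classes_def using conjugacy_class_subset conjugacy_class_self by blast
  show "{} \<notin> conjugacy_classes G"
    using conjugacy_class_self unfolding conjugacy_classes_def by blast
  show "disjnt p q" if "p \<in> conjugacy_classes G" "q \<in> conjugacy_classes G" "p \<noteq> q" for p q
    using that conjugacy_class_eq unfolding conjugacy_classes_def disjnt_def by blast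
qed

text \<open>The class of a representative of a block stays inside that block, and disjoint blocks
  therefore yield different classes.\<close>

lemma conj_invariant_partition_imp_classes:
  assumes "partition_on (carrier G) P" "finite P" "\<And>E. E \<in> P \<Longrightarrow> conj_invariant G E"
  shows "\<exists>S \<subseteq> conjugacy_classes G. finite S \<and> card S = card P"
proof -
  have sub: "E \<subseteq> carrier G" if "E \<in> P" for E
    using assms(1) that by (auto dest: partition_onD1)
  have "\<exists>x. x \<in> E" if "E \<in> P" for E
    using assms(1) that by (metis all_not_in_conv partition_onD3)
  then obtain r where r: "\<And>E. E \<in> P \<Longrightarrow> r E \<in> E" by metis
  let ?f = "\<lambda>E. conjugacy_class G (r E)"
  have f: "?f E \<subseteq> E" "r E \<in> ?f E" if "E \<in> P" for E
    using conj_invariant_iff[OF sub] assms(3) r sub conjugacy_class_self that by blast+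
  have "inj_on ?f P"
  proof (rule inj_onI)
    fix E F assume "E \<in> P" "F \<in> P" "?f E = ?f F"
    then have "r E \<in> E \<inter> F" using f by blast
    then show "E = F"
      using partition_onD2[OF assms(1)] \<open>E \<in> P\<close> \<open>F \<in> P\<close> by (metis disjointD empty_iff)
  qed
  then have "card (?f ` P) = card P" by (rule card_image)
  moreover have "?f ` P \<subseteq> conjugacy_classes G"
    unfolding conjugacy_classes_def using r sub by blast
  ultimately show ?thesis using assms(2) by blast
qed

text \<open>All but one of the chosen classes become blocks; the last block collects everything else.\<close>

lemma classes_imp_conj_invariant_partition:
  assumes "S \<subseteq> conjugacy_classes G" "finite S" "S \<noteq> {}"
  shows "\<exists>P. partition_on (carrier G) P \<and> finite P \<and> card P = card S \<and>
    (\<forall>E \<in> P. conj_invariant G E)"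
proof -
  note part = partition_on_conjugacy_classes
  obtain c T where S: "S = insert c T" "c \<notin> T" using assms(3)
    by (metis Set.set_insert all_not_in_conv)
  have T: "T \<subseteq> conjugacy_classes G" "finite T" and c: "c \<in> conjugacy_classes G"
    using assms S by auto
  let ?R = "carrier G - \<Union>T"
  have c_sub: "c \<subseteq> ?R" "c \<noteq> {}"
  proof -
    show "c \<noteq> {}" using c partition_onD3[OF part] by blast
    have "c \<inter> t = {}" if "t \<in> T" for t
      using disjointD[OF partition_onD2[OF part] c] that T(1) S(2) by blast
    then show "c \<subseteq> ?R" using c partition_onD1[OF part] by blast
  qed
  \<comment> \<open>The class \<open>c\<close> that was set aside keeps the remainder nonempty. A
    member of \<open>T\<close> lies in the union of \<open>T\<close>, which the remainder avoids, so
    the remainder is a new block.\<close>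
  then have R: "?R \<noteq> {}" "?R \<notin> T" using Union_upper[of ?R T] by auto
  have T_inv: "conj_invariant G E" if E: "E \<in> T" for E
  proof -
    obtain x where x: "x \<in> carrier G" "E = conjugacy_class G x"
      using subsetD[OF T(1) E] unfolding conjugacy_classes_def by blast
    then show ?thesis
      using conj_invariant_iff[of E] conjugacy_class_subset conjugacy_class_mono by blast
  qed
  \<comment> \<open>Equivalences of membership pass to unions and complements.\<close>
  have "conj_invariant G ?R"
    using T_inv unfolding conj_invariant_def by simp
  moreover have "partition_on (carrier G) (insert ?R T)"
  proof (rule partition_onI)
    show "\<Union> (insert ?R T) = carrier G" using T(1) partition_onD1[OF part] by blast
    show "{} \<notin> insert ?R T" using T(1) R(1) partition_onD3[OF part] by blast
    show "disjnt p q" if "p \<in> insert ?R T" "q \<in> insert ?R T" "p \<noteq> q" for p q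
      using that disjointD[OF partition_onD2[OF part], of p q] T(1) unfolding disjnt_def by blast
  qed
  moreover have "card (insert ?R T) = card S"
    using S R(2) T(2) by simp
  ultimately show ?thesis using T(2) T_inv by (intro exI[of _ "insert ?R T"]) auto
qed

text \<open>Every generated element is the value of a finite word in the generators and their
  inverses, and there are only countably many such words.\<close>

lemma countable_generate:
  assumes "countable S" "S \<subseteq> carrier G"
  shows "countable (generate G S)"
proof -
  let ?L = "S \<union> m_inv G ` S" and ?w = "\<lambda>l. foldr (\<otimes>) l \<one>"
  have L: "?L \<subseteq> carrier G" using assms(2) by auto
  have w_closed: "?w l \<in> carrier G" if "l \<in> lists ?L" for l
    using that L by (induction l) auto
  have w_append: "?w (l @ k) = ?w l \<otimes> ?w k" if "l \<in> lists ?L" "k \<in> lists ?L" for l k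
    using that(1)
  proof (induction l)
    case Nil
    then show ?case using w_closed[OF that(2)] by simp
  next
    case (Cons a l)
    then have "a \<in> carrier G" using L by blast
    with Cons show ?case using w_closed[of l] w_closed[OF that(2)] by (simp add: m_assoc)
  qed
  have letter: "a \<in> ?w ` lists ?L" if "a \<in> ?L" for a
    using that L by (intro image_eqI[of _ _ "[a]"]) auto
  have "generate G S \<subseteq> ?w ` lists ?L"
  proof
    fix x assume "x \<in> generate G S"
    then show "x \<in> ?w ` lists ?L"
    proof (induction x rule: generate.induct)
      case one
      then show ?case by (intro image_eqI[of _ _ "[]"]) auto
    next
      case (eng h k)
      then obtain l l' where "h = ?w l" "k = ?w l'" "l \<in> lists ?L" "l' \<in> lists ?L" by blast
      then show ?case using w_append by (intro image_eqI[of _ _ "l @ l'"]) auto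
    qed (use letter in auto)
  qed
  moreover have "countable (?w ` lists ?L)" using assms(1) by auto
  ultimately show ?thesis by (rule countable_subset)
qed

end

subsection \<open>Transfer between equivalent groups\<close>

text \<open>Classes of \<open>G\<close> become a partition into as many invariant blocks. A pair of
  \<open>H\<close> with the same configurations has equally many blocks, again invariant, and each
  of them contains a class of \<open>H\<close>.\<close>

lemma two_sided_equivalent_classes:
  fixes G :: "('a, 'c) monoid_scheme" and H :: "('b, 'd) monoid_scheme"
  assumes "finitely_generated_group G" "group H" "two_sided_equivalent G H"
    and "S \<subseteq> conjugacy_classes G" "finite S"
  shows "\<exists>T \<subseteq> conjugacy_classes H. finite T \<and> card T = card S"
\<comment> \<open>The carrier is nonempty and has no partition into zero blocks, so empty
  \<open>S\<close> is split off.\<close>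
proof (cases "S = {}")
  case False
  have G: "group G" using assms(1) by (simp add: finitely_generated_group_def)
  obtain A where A: "finite A" "A \<subseteq> carrier G" "generate G A = carrier G"
    using assms(1) by (auto simp: finitely_generated_group_def)
  obtain gs where gs: "set gs = A" using finite_list[OF A(1)] by blast
  obtain P where P: "partition_on (carrier G) P" "finite P" "card P = card S"
    "\<forall>E \<in> P. conj_invariant G E"
    using group.classes_imp_conj_invariant_partition[OF G assms(4,5) False] by blast
  obtain Es where Es: "set Es = P" "distinct Es" using finite_distinct_list[OF P(2)] by blast
  have pair_G: "configuration_pair G gs Es"
    using A gs P Es by (simp add: configuration_pair_def)
  then have "Con_t_pair G gs Es \<in> Con_t H"
    using assms(3) unfolding two_sided_equivalent_def Con_t_def by blast
  then obtain hs Fs where eq: "Con_t_pair G gs Es = Con_t_pair H hs Fs"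
    and pair_H: "configuration_pair H hs Fs"
    unfolding Con_t_def by blast
  have hs: "set hs \<subseteq> carrier H" "generate H (set hs) = carrier H"
    and Fs: "distinct Fs" "partition_on (carrier H) (set Fs)"
    using pair_H by (auto simp: configuration_pair_def)
  have "{1..length Es} = {1..length Fs}"
    using Con_t_pair_nth_0_image[OF G pair_G] Con_t_pair_nth_0_image[OF assms(2) pair_H] eq by metis
  then have "length Es = length Fs" by (metis card_atLeastAtMost diff_Suc_1 One_nat_def)
  then have card: "card (set Fs) = card S"
    using Es Fs(1) P(3) by (metis distinct_card)
  \<comment> \<open>The length of the tuple is read off from a single configuration, so one must
    exist; the unit element supplies it.\<close>
  have "Con_t_pair G gs Es \<noteq> {}"
    using Con_t_pair_eq_image[OF G pair_G] group.is_monoid[OF G] monoid.one_closed by blast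
  then obtain C where "C \<in> Con_t_pair G gs Es" "C \<in> Con_t_pair H hs Fs" using eq by blast
  then have len: "length gs = length hs" unfolding Con_t_pair_def by simp
  have "\<forall>E \<in> set Es. \<forall>g \<in> set gs. \<forall>x \<in> carrier G. g \<otimes>\<^bsub>G\<^esub> x \<in> E \<longleftrightarrow> x \<otimes>\<^bsub>G\<^esub> g \<in> E"
    using P(4) Es(1) gs A(2) unfolding conj_invariant_def by blast
  then have "\<forall>F \<in> set Fs. \<forall>h \<in> set hs. \<forall>x \<in> carrier H. h \<otimes>\<^bsub>H\<^esub> x \<in> F \<longleftrightarrow> x \<otimes>\<^bsub>H\<^esub> h \<in> F"
    using Con_t_pair_symmetric_iff[OF G pair_G] Con_t_pair_symmetric_iff[OF assms(2) pair_H] eq len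
    by simp
  then have "conj_invariant H F" if "F \<in> set Fs" for F
    using that by (intro group.conj_invariant_generate[OF assms(2) hs(2,1)]) blast
  then show ?thesis
    using group.conj_invariant_partition_imp_classes[OF assms(2) Fs(2)] card by simp
qed auto

section \<open>Countability and comparison of cardinalities\<close>

lemma countable_conjugacy_classes:
  assumes "finitely_generated_group G"
  shows "countable (conjugacy_classes G)"
proof -
  obtain A where "group G" "finite A" "A \<subseteq> carrier G" "generate G A = carrier G"
    using assms by (auto simp: finitely_generated_group_def)
  then have "countable (carrier G)"
    using group.countable_generate[of G A] countable_finite by metis
  then show ?thesis by (simp add: conjugacy_classes_def)
qed

text \<open>An infinite \<open>A\<close> would contain a finite subset with one element more than
  \<open>B\<close>.\<close>

lemma finite_card_le_if_subset_cards:
  assumes "finite B"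
    and AB: "\<And>S. S \<subseteq> A \<Longrightarrow> finite S \<Longrightarrow> \<exists>T \<subseteq> B. finite T \<and> card T = card S"
  shows "finite A \<and> card A \<le> card B"
proof -
  have bound: "card S \<le> card B" if "S \<subseteq> A" "finite S" for S
    using AB[OF that] assms(1) by (metis card_mono)
  have "finite A"
  proof (rule ccontr)
    assume "infinite A"
    then obtain S where "S \<subseteq> A" "finite S" "card S = Suc (card B)"
      using infinite_arbitrarily_large by blast
    then show False using bound[of S] by simp
  qed
  then show ?thesis using bound by blast
qed

text \<open>Sizes of finite subsets determine a finite cardinality but cannot separate infinite
  ones; countability leaves only one infinite cardinality.\<close>

lemma same_finite_subset_cards_imp_eqpoll:
  assumes "countable A" "countable B"
    and AB: "\<And>S. S \<subseteq> A \<Longrightarrow> finite S \<Longrightarrow> \<exists>T \<subseteq> B. finite T \<and> card T = card S"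
    and BA: "\<And>T. T \<subseteq> B \<Longrightarrow> finite T \<Longrightarrow> \<exists>S \<subseteq> A. finite S \<and> card S = card T"
  shows "A \<approx> B"
proof (cases "finite B")
  case True
  then have A: "finite A" "card A \<le> card B"
    using finite_card_le_if_subset_cards[OF _ AB] by blast+
  then have "card B \<le> card A"
    using finite_card_le_if_subset_cards[OF _ BA] by blast
  then show ?thesis using True A by (simp add: eqpoll_iff_card)
next
  case False
  then have "infinite A" using finite_card_le_if_subset_cards[OF _ BA] by blast
  then have "bij_betw (to_nat_on A) A UNIV" "bij_betw (to_nat_on B) B UNIV"
    using False assms(1,2) by (simp_all add: to_nat_on_infinite)
  then show ?thesis unfolding eqpoll_def using bij_betw_trans bij_betw_inv_into by blast
qed

theorem theorem2p7:
  fixes G :: "('a, 'c) monoid_scheme" and H :: "('b, 'd) monoid_scheme"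
  assumes "finitely_generated_group G" and "finitely_generated_group H"
    and "two_sided_equivalent G H"
  shows "same_class_number G H"
proof -
  have G: "group G" and H: "group H"
    using assms by (auto simp: finitely_generated_group_def)
  \<comment> \<open>The transfer of classes is one-directional and is applied both ways.\<close>
  have sym: "two_sided_equivalent H G" using assms(3) by (simp add: two_sided_equivalent_def)
  show ?thesis
    unfolding same_class_number_def
    using countable_conjugacy_classes[OF assms(1)] countable_conjugacy_classes[OF assms(2)]
      two_sided_equivalent_classes[OF assms(1) H assms(3)]
      two_sided_equivalent_classes[OF assms(2) G sym]
    by (rule same_finite_subset_cards_imp_eqpoll)
qed

end
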